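(* Let $k\in\mathbb{N}$. (C-1) Suppose that for a Levin-type sequence transformation $\mathcal{T}^{(k)}$ of order $k$ with coefficients $\lambda^{(k)}_{n,j}$ there is a limiting transformation with coefficients $\mathring\lambda^{(k)}_j$ and characteristic polynomial $$\mathring\Pi^{(k)}(z)=\sum_{j=0}^k\mathring\lambda^{(k)}_jz^j=\prod_{\ell=1}^{M}(z-\zeta_\ell)^{m_\ell},$$ where the multiplicities $m_\ell$ of the (distinct) zeroes $\zeta_\ell\neq0$ satisfy $m_1\le m_2\le\dots\le m_M$. Let $$\lambda^{(k)}_{n,j}\frac{n^{m_1-1}}{(n+j)^{m_1-1}}\sim\mathring\lambda^{(k)}_j\left(\sum_{t=0}^\infty\frac{e^{(k)}_t}{(n+j)^t}\right),\qquad e^{(k)}_0=1,$$ for $n\to\infty$. (C-2) Assume that $\{s_n\}$ is a sequence in $\mathbb{K}$ and $\{\omega_n\}$ a sequence of nonzero elements of $\mathbb{K}$. Assume further that for $n\to\infty$ the asymptotic expansion $$\frac{s_n-s}{\omega_n}\sim\sum_{\ell=1}^M\zeta_\ell^n\sum_{r=0}^\infty c_{\ell,r}n^{-r}$$ holds, and put $$r_\ell=\min\{r\in\mathbb{N}_0\mid f_{\ell,r+m_1}\neq0\},\qquad f_{\ell,v}=\sum_{r=0}^ve^{(k)}_{v-r}c_{\ell,r},\qquad B_\ell=(-1)^{m_\ell}\frac{d^{m_\ell}\mathring\Pi^{(k)}}{dx^{m_\ell}}(\zeta_\ell)$$ for $\ell=1,\dots,M$. (C-3) Assume that the following limit exists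 and satisfies $$0\neq\lim_{n\to\infty}\frac{\omega_{n+1}}{\omega_n}=\rho\notin\{\zeta_\ell^{-1}\mid\ell=1,\dots,M\}.$$ Then $$\frac{\mathcal{T}^{(k)}_n(\{s_n\},\{\omega_n\})-s}{\omega_n}\sim\frac{\displaystyle\sum_{\ell=1}^Mf_{\ell,r_\ell+m_1}\zeta_\ell^{n+m_\ell}\binom{r_\ell+m_\ell}{r_\ell}\frac{B_\ell}{n^{r_\ell+m_\ell-m_1}}}{\mathring\Pi^{(k)}(1/\rho)}\,\frac1{n^{2m_1}}\qquad(n\to\infty).$$ Thus $\{\mathcal{T}^{(k)}_n(\{s_n\},\{\omega_n\})\}$ accelerates $\{s_n\}$ to $s$ at least with order $2m_1$, i.e. $$\frac{\mathcal{T}^{(k)}_n-s}{s_n-s}=O(n^{-2m_1-\tau}),\qquad\tau\ge0,$$ if $c_{\ell,0}\neq0$ for all $\ell$.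
   Context: $\mathbb{K}$ denotes $\mathbb{R}$ or $\mathbb{C}$; $\mathbb{N}=\{1,2,\dots\}$, $\mathbb{N}_0=\mathbb{N}\cup\{0\}$. A coefficient set of order $k$ is a family $\lambda^{(k)}_{n,j}\in\mathbb{K}$ ($n\in\mathbb{N}_0$, $0\le j\le k$) with $\lambda^{(k)}_{n,k}\neq0$ for all $n$. The corresponding Levin-type sequence transformation of order $k$ maps a sequence $\{s_n\}$ in $\mathbb{K}$ and a sequence $\{\omega_n\}$ of nonzero elements of $\mathbb{K}$, with $\sum_{j=0}^k\lambda^{(k)}_{n,j}/\omega_{n+j}\neq0$, to $$\mathcal{T}^{(k)}_n(\{s_n\},\{\omega_n\})=\frac{\sum_{j=0}^k\lambda^{(k)}_{n,j}\,s_{n+j}/\omega_{n+j}}{\sum_{j=0}^k\lambda^{(k)}_{n,j}/\omega_{n+j}}.$$ A limiting transformation exists if the limits $\mathring\lambda^{(k)}_j=\lim_{n\to\infty}\lambda^{(k)}_{n,j}$ exist for all $0\le j\le k$ and $\mathring\lambda^{(k)}_k\neq0$; it is the Levin-type transformation with the $n$-independent coefficients $\mathring\lambda^{(k)}_j$. The number $s\in\mathbb{K}$ is the limit (or antilimit) of $\{s_n\}$. The symbol $\sim$ between an expression and an infinite series in inverse powers denotes an asymptotic expansion as $n\to\infty$; between two expressions it denotes asymptotic equality as $n\to\infty$.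
   Formalization: As terms of different ζ_ℓ can cancel, ∼ is proved with error o(sum of the terms' moduli), and literally only along those n where the terms do not cancel; the O-bound is proved only along those n where the sum of c_{ℓ,0}ζ_ℓ^n does not cancel. *)

theory Defs
  imports Complex_Main "HOL-Library.Landau_Symbols" "HOL-Computational_Algebra.Polynomial"
begin

unbundle asymp_equiv_syntax

text \<open>
  The scalar field is a set \<open>K\<close> of complex numbers, which is either the real numbers or
  everything. This leaves room for non-real zeroes of a characteristic polynomial with real
  coefficients.
\<close>

definition coefficient_set :: "complex set \<Rightarrow> nat \<Rightarrow> (nat \<Rightarrow> nat \<Rightarrow> complex) \<Rightarrow> bool" where
  "coefficient_set K k lam \<longleftrightarrow> (\<forall>n. \<forall>j\<le>k. lam n j \<in> K) \<and> (\<forall>n. lam n k \<noteq> 0)"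

definition levin_domain ::
  "complex set \<Rightarrow> nat \<Rightarrow> (nat \<Rightarrow> nat \<Rightarrow> complex) \<Rightarrow> (nat \<Rightarrow> complex) \<Rightarrow> (nat \<Rightarrow> complex) \<Rightarrow> bool" where
  "levin_domain K k lam S \<omega> \<longleftrightarrow>
     (\<forall>n. S n \<in> K) \<and> (\<forall>n. \<omega> n \<in> K \<and> \<omega> n \<noteq> 0) \<and> (\<forall>n. (\<Sum>j\<le>k. lam n j / \<omega> (n + j)) \<noteq> 0)"

definition levin_transform ::
  "nat \<Rightarrow> (nat \<Rightarrow> nat \<Rightarrow> complex) \<Rightarrow> (nat \<Rightarrow> complex) \<Rightarrow> (nat \<Rightarrow> complex) \<Rightarrow> nat \<Rightarrow> complex" where
  "levin_transform k lam S \<omega> n =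
     (\<Sum>j\<le>k. lam n j * S (n + j) / \<omega> (n + j)) / (\<Sum>j\<le>k. lam n j / \<omega> (n + j))"

definition limiting_coefficients ::
  "nat \<Rightarrow> (nat \<Rightarrow> nat \<Rightarrow> complex) \<Rightarrow> (nat \<Rightarrow> complex) \<Rightarrow> bool" where
  "limiting_coefficients k lam lam0 \<longleftrightarrow>
     (\<forall>j\<le>k. (\<lambda>n. lam n j) \<longlonglongrightarrow> lam0 j) \<and> lam0 k \<noteq> 0"

definition characteristic_poly :: "nat \<Rightarrow> (nat \<Rightarrow> complex) \<Rightarrow> complex poly" where
  "characteristic_poly k lam0 = (\<Sum>j\<le>k. monom (lam0 j) j)"

text \<open>
  Poincare expansion in inverse powers of \<open>x n\<close>, as \<open>n\<close> tends to infinity. The scale is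
  \<open>x n\<close> to the power \<open>-N\<close>, whether or not the coefficient \<open>a N\<close> vanishes.
\<close>

definition inverse_power_expansion ::
  "(nat \<Rightarrow> complex) \<Rightarrow> (nat \<Rightarrow> complex) \<Rightarrow> (nat \<Rightarrow> complex) \<Rightarrow> bool" where
  "inverse_power_expansion f x a \<longleftrightarrow>
     (\<forall>N. (\<lambda>n. f n - (\<Sum>t\<le>N. a t / x n ^ t)) \<in> o(\<lambda>n. 1 / x n ^ N))"

text \<open>
  The expansion of \<open>f\<close> as the sum over \<open>l \<in> I\<close> of \<open>\<zeta> l ^ n\<close> times the formal series with
  coefficients \<open>c l r\<close> in inverse powers of \<open>n\<close>. After truncation at \<open>N\<close> each series may be off by
  \<open>o\<close> of \<open>n\<close> to the power \<open>-N\<close>, so the total remainder is measured against the sum of the moduli.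
\<close>

definition exp_power_expansion ::
  "(nat \<Rightarrow> complex) \<Rightarrow> nat set \<Rightarrow> (nat \<Rightarrow> complex) \<Rightarrow> (nat \<Rightarrow> nat \<Rightarrow> complex) \<Rightarrow> bool" where
  "exp_power_expansion f I \<zeta> c \<longleftrightarrow>
     (\<forall>N. (\<lambda>n. norm (f n - (\<Sum>l\<in>I. \<zeta> l ^ n * (\<Sum>r\<le>N. c l r / of_nat n ^ r))))
            \<in> o(\<lambda>n. \<Sum>l\<in>I. norm (\<zeta> l) ^ n / real n ^ N))"

text \<open>
  Asymptotic equality of \<open>f\<close> with a sum of possibly oscillating terms \<open>g l\<close>. The sum may vanish,
  or be much smaller than its terms, for infinitely many \<open>n\<close>; a quotient limit is then the wrong
  notion, and the error is required to be small compared with the terms. Wherever the terms do not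
  cancel (see \<open>noncancelling\<close>) this is asymptotic equality in the usual sense.
\<close>

definition asymp_equiv_sum ::
  "nat filter \<Rightarrow> (nat \<Rightarrow> complex) \<Rightarrow> nat set \<Rightarrow> (nat \<Rightarrow> nat \<Rightarrow> complex) \<Rightarrow> bool" where
  "asymp_equiv_sum F f I g \<longleftrightarrow>
     (\<lambda>n. norm (f n - (\<Sum>l\<in>I. g l n))) \<in> o[F](\<lambda>n. \<Sum>l\<in>I. norm (g l n))"

text \<open>
  With \<open>F \<le> sequentially\<close>, a filter \<open>F\<close> may pick out any subsequence; \<open>F = sequentially\<close> gives
  all large \<open>n\<close>. The condition is automatic for every such \<open>F\<close> if \<open>I\<close> is a singleton.
\<close>

definition noncancelling ::
  "nat filter \<Rightarrow> nat set \<Rightarrow> (nat \<Rightarrow> nat \<Rightarrow> complex) \<Rightarrow> bool" where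
  "noncancelling F I g \<longleftrightarrow>
     (\<lambda>n. \<Sum>l\<in>I. norm (g l n)) \<in> O[F](\<lambda>n. norm (\<Sum>l\<in>I. g l n))"

end

theory Submission imports Defs begin

text \<open>
  The denominator of the transformed error, multiplied by \<open>\<omega> n\<close>, tends to the characteristic
  polynomial at \<open>1 / \<rho>\<close>. Multiplying the expansions of the coefficients and of the error turns
  the numerator into a sum over the zeroes \<open>\<zeta>\<close> of \<open>\<zeta> ^ n\<close> times combinations of
  \<open>\<Sum>j. \<lambda>\<^sub>j \<zeta> ^ j (n + j) ^ (m\<^sub>1 - 1 - v)\<close>. The moments \<open>\<Sum>j. \<lambda>\<^sub>j \<zeta> ^ j j ^ i\<close> vanish for \<open>i\<close> below
  the multiplicity \<open>m\<close> of \<open>\<zeta>\<close>, because they are values at \<open>\<zeta>\<close> of iterates of \<open>z d/dz\<close> on the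
  polynomial. Hence the terms with \<open>v < m\<^sub>1\<close> drop out, and every other term gains a factor
  \<open>n ^ (-m)\<close>. The remainder can be taken beyond any fixed power of \<open>n\<close>, so the leading terms
  dominate it. The order of acceleration holds with \<open>\<tau> = 0\<close>.
\<close>

text \<open>The definitions measure the norm of an error against a real scale, whereas the Landau
  estimates for products are carried out with complex functions; this passes between the
  two.\<close>

lemma norm_smallo_iff:
  fixes f :: "'a \<Rightarrow> complex"
  shows "(\<lambda>x. norm (f x)) \<in> o[F](U) \<longleftrightarrow> f \<in> o[F](\<lambda>x. complex_of_real (U x))"
  by (simp add: smallo_def)

section \<open>Power moments of the coefficients at a multiple zero\<close>

text \<open>The cases \<open>h = 1\<close> and \<open>h = z\<close> give ordinary derivatives and power moments.\<close>

lemma poly_derivation_power_root: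
  fixes h Q :: "'a::{idom,ring_char_0} poly"
  assumes "i \<le> m"
  shows "poly (((\<lambda>p. h * pderiv p) ^^ i) ([:-a, 1:] ^ m * Q)) a
       = (if i < m then 0 else fact m * poly h a ^ m * poly Q a)"
  using assms
proof (induction m arbitrary: i Q)
  case 0
  then show ?case by simp
next
  case (Suc m)
  show ?case
  proof (cases i)
    case 0
    then show ?thesis by simp
  next
    case (Suc i')
    \<comment> \<open>One application lowers the exponent by one and leaves this cofactor. At
      \<open>a\<close> only its first summand survives, which supplies the factor
      \<open>Suc m\<close> of the factorial.\<close>
    define Q' where "Q' = h * (smult (of_nat (Suc m)) Q + [:-a, 1:] * pderiv Q)"
    have "h * pderiv ([:-a, 1:] ^ Suc m * Q) = [:-a, 1:] ^ m * Q'"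
      unfolding pderiv_mult pderiv_power_Suc Q'_def
      by (simp add: pderiv_pCons algebra_simps del: of_nat_Suc)
    then have "((\<lambda>p. h * pderiv p) ^^ i) ([:-a, 1:] ^ Suc m * Q)
        = ((\<lambda>p. h * pderiv p) ^^ i') ([:-a, 1:] ^ m * Q')"
      by (simp add: Suc funpow_Suc_right del: funpow.simps power_Suc)
    moreover have "poly Q' a = poly h a * (of_nat (Suc m) * poly Q a)"
      by (simp add: Q'_def)
    ultimately show ?thesis
      using Suc.IH[of i' Q'] Suc.prems Suc by (simp add: algebra_simps)
  qed
qed

text \<open>Monomials are eigenvectors of \<open>z d/dz\<close>, with eigenvalue \<open>j\<close>
  for \<open>z ^ j\<close>, so every application contributes one factor
  \<open>of_nat j\<close>.\<close>

lemma funpow_euler_operator: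
  fixes a :: "nat \<Rightarrow> 'a::{idom,ring_char_0}"
  shows "((\<lambda>p. monom 1 1 * pderiv p) ^^ i) (\<Sum>j\<le>k. monom (a j) j)
       = (\<Sum>j\<le>k. monom (of_nat j ^ i * a j) j)"
proof (induction i)
  case (Suc i)
  have "monom 1 1 * pderiv (monom b j) = monom (of_nat j * b) j" for b :: 'a and j
    by (cases j) (simp_all add: pderiv_monom mult_monom)
  then show ?case
    using Suc by (simp add: higher_pderiv_sum[of 1, simplified] sum_distrib_left mult.assoc)
qed simp

text \<open>The same iterate of \<open>z d/dz\<close> is evaluated at \<open>z\<close> in two ways:
  summand by summand it gives the moment, and through the factorization it is the value at a root,
  where \<open>h\<close> takes the value \<open>z\<close>.\<close>

lemma moments_root:
  fixes a :: "nat \<Rightarrow> 'a::{idom,ring_char_0}"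
  assumes "(\<Sum>j\<le>k. monom (a j) j) = [:-z, 1:] ^ m * Q" and "i \<le> m"
  shows "(\<Sum>j\<le>k. a j * z ^ j * of_nat j ^ i) = (if i < m then 0 else fact m * z ^ m * poly Q z)"
  using poly_derivation_power_root[OF assms(2), of "monom 1 1" z Q]
    arg_cong[OF funpow_euler_operator[of i a k], of "\<lambda>p. poly p z"]
  unfolding assms(1)
  by (simp add: poly_sum poly_monom mult_ac split: if_splits)

text \<open>Serves to express the first nonvanishing moment by the derivative that defines
  \<open>B\<close>: both contain the value of the cofactor at the zero.\<close>

lemma poly_funpow_pderiv_root:
  fixes Q :: "'a::{idom,ring_char_0} poly"
  shows "poly ((pderiv ^^ m) ([:-a, 1:] ^ m * Q)) a = fact m * poly Q a"
  using poly_derivation_power_root[of m m 1 a Q] by simp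

section \<open>Asymptotics of sums whose low moments vanish\<close>

text \<open>The binomial expansion of the shifted power involves only moments of order at most
  \<open>d\<close>. This removes all terms in which \<open>n + j\<close> has a nonnegative
  exponent.\<close>

lemma sum_shifted_power_eq_0:
  fixes w :: "nat \<Rightarrow> 'a::comm_ring_1"
  assumes "\<And>i. i < m \<Longrightarrow> (\<Sum>j\<le>k. w j * of_nat j ^ i) = 0" and "d < m"
  shows "(\<Sum>j\<le>k. w j * (of_nat j + x) ^ d) = 0"
proof -
  have "(\<Sum>j\<le>k. w j * (of_nat j + x) ^ d)
      = (\<Sum>j\<le>k. \<Sum>i\<le>d. of_nat (d choose i) * x ^ (d - i) * (w j * of_nat j ^ i))"
    by (simp add: binomial_ring sum_distrib_left mult_ac)
  also have "\<dots> = (\<Sum>i\<le>d. of_nat (d choose i) * x ^ (d - i) * (\<Sum>j\<le>k. w j * of_nat j ^ i))"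
    by (subst sum.swap) (simp add: sum_distrib_left)
  also have "\<dots> = 0"
    using assms by (intro sum.neutral) auto
  finally show ?thesis .
qed

lemma ratio_shift_tendsto:
  "(\<lambda>n. (of_nat n / of_nat (n + j)) ^ q :: complex) \<longlonglongrightarrow> 1"
proof -
  have "(\<lambda>n. (1 / (1 + of_nat j * (1 / of_nat n))) ^ q :: complex) \<longlonglongrightarrow> (1 / (1 + of_nat j * 0)) ^ q"
    by (intro tendsto_intros lim_1_over_n) auto
  then have "(\<lambda>n. (1 / (1 + of_nat j * (1 / of_nat n))) ^ q :: complex) \<longlonglongrightarrow> 1"
    by simp
  then show ?thesis
    by (rule Lim_transform_eventually)
      (use eventually_gt_at_top[of 0] in \<open>eventually_elim, simp add: field_simps\<close>)
qed

text \<open>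
  Since \<open>n / (n + j) = 1 - j / (n + j)\<close>, raising the exponent of \<open>n + j\<close> trades against
  raising the moment; this reduces everything to the first nonvanishing moment.
\<close>

lemma sum_moment_inverse_power_tendsto:
  fixes w :: "nat \<Rightarrow> complex"
  assumes moments_0: "\<And>i. i < m \<Longrightarrow> (\<Sum>j\<le>k. w j * of_nat j ^ i) = 0"
    and moment_m: "(\<Sum>j\<le>k. w j * of_nat j ^ m) = c"
    and "d \<le> m"
  shows "(\<lambda>n. of_nat n ^ (q + d) * (\<Sum>j\<le>k. w j * of_nat j ^ (m - d) / of_nat (n + j) ^ q))
           \<longlonglongrightarrow> (- 1) ^ d * of_nat ((q + d - 1) choose d) * c"
  using \<open>d \<le> m\<close>
proof (induction d arbitrary: q)
  \<comment> \<open>The truncated subtraction is harmless here: the binomial coefficient is 1 also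
    for \<open>q = 0\<close>.\<close>
  case 0
  have "(\<lambda>n. \<Sum>j\<le>k. w j * of_nat j ^ m * (of_nat n / of_nat (n + j)) ^ q) \<longlonglongrightarrow> (\<Sum>j\<le>k. w j * of_nat j ^ m * 1)"
    by (intro tendsto_sum tendsto_mult tendsto_const ratio_shift_tendsto)
  then show ?case
    by (simp add: sum_distrib_left moment_m power_divide mult_ac)
next
  case (Suc d)
  note IHd = Suc
  show ?case
  proof (induction q)
    \<comment> \<open>The sum is then a moment of order below \<open>m\<close>, and the claimed
      limit contains \<open>d choose Suc d\<close>, which is 0.\<close>
    case 0
    then show ?case
      using IHd(2) by (simp add: moments_0 binomial_eq_0)
  next
    case (Suc q)
    let ?u = "\<lambda>q i n. \<Sum>j\<le>k. w j * of_nat j ^ i / of_nat (n + j) ^ q :: complex"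
    define i where "i = m - Suc d"
    have i: "m - d = Suc i" using IHd(2) by (simp add: i_def)
    have rec: "of_nat n * ?u (Suc q) i n = ?u q i n - ?u (Suc q) (Suc i) n" if "n > 0" for n
      unfolding sum_distrib_left sum_subtractf[symmetric]
    proof (rule sum.cong[OF refl])
      fix j
      \<comment> \<open>Used with \<open>x = n + j\<close> and \<open>y = j\<close>, so that
        \<open>x - y\<close> is \<open>n\<close>.\<close>
      have alg: "(x - y) * (a / x ^ Suc q) = a / x ^ q - a * y / x ^ Suc q" if "x \<noteq> 0" for x y a :: complex
        using that by (simp add: field_simps)
      have "of_nat (n + j) \<noteq> (0::complex)"
        using that by (metis add_gr_0 of_nat_eq_0_iff less_numeral_extra(3))
      from alg[OF this, of "of_nat j" "w j * of_nat j ^ i"]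
      show "of_nat n * (w j * of_nat j ^ i / of_nat (n + j) ^ Suc q)
          = w j * of_nat j ^ i / of_nat (n + j) ^ q - w j * of_nat j ^ Suc i / of_nat (n + j) ^ Suc q"
        by (simp add: mult_ac)
    qed
    \<comment> \<open>The first limit is the inner hypothesis at \<open>q\<close>, the second the
      outer hypothesis at \<open>Suc q\<close>. The signs differ, so Pascal's rule adds up the
      binomial coefficients.\<close>
    have "(\<lambda>n. of_nat n ^ (q + Suc d) * ?u q i n - of_nat n ^ (Suc q + d) * ?u (Suc q) (Suc i) n)
        \<longlonglongrightarrow> (- 1) ^ Suc d * of_nat ((q + Suc d - 1) choose Suc d) * c
          - (- 1) ^ d * of_nat ((Suc q + d - 1) choose d) * c"
      using IHd(1)[of "Suc q"] IHd(2) Suc unfolding i i_def by (intro tendsto_diff) auto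
    also have "(- 1) ^ Suc d * of_nat ((q + Suc d - 1) choose Suc d) * c
          - (- 1) ^ d * of_nat ((Suc q + d - 1) choose d) * c
        = (- 1) ^ Suc d * of_nat ((Suc q + Suc d - 1) choose Suc d) * c"
      by (simp add: algebra_simps)
    finally show ?case
    proof (rule Lim_transform_eventually)
      show "\<forall>\<^sub>F n in sequentially. of_nat n ^ (q + Suc d) * ?u q i n
           - of_nat n ^ (Suc q + d) * ?u (Suc q) (Suc i) n
         = of_nat n ^ (Suc q + Suc d) * ?u (Suc q) (m - Suc d) n"
        using eventually_gt_at_top[of 0]
      proof eventually_elim
        case (elim n)
        have "of_nat n ^ (q + Suc d) * ?u q i n - of_nat n ^ (Suc q + d) * ?u (Suc q) (Suc i) n
            = of_nat n ^ (q + Suc d) * (?u q i n - ?u (Suc q) (Suc i) n)"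
          by (simp add: right_diff_distrib)
        also have "\<dots> = of_nat n ^ (Suc q + Suc d) * ?u (Suc q) i n"
          unfolding rec[OF elim, symmetric] by (simp add: mult_ac)
        finally show ?case unfolding i_def .
      qed
    qed
  qed
qed

text \<open>The index \<open>v\<close> runs through four ranges. For \<open>v \<le> p\<close> the
  summand is a polynomial in \<open>j\<close> of degree below \<open>m\<close> and is annihilated;
  up to \<open>Suc p + r\<close> the coefficients vanish; at \<open>Suc p + r\<close> the leading
  term arises; beyond it the terms are of lower order. Hence the limit is the same for every
  sufficiently large truncation order \<open>N\<close>.\<close>

lemma annihilated_expansion_tendsto:
  fixes w f :: "nat \<Rightarrow> complex"
  assumes moments_0: "\<And>i. i < m \<Longrightarrow> (\<Sum>j\<le>k. w j * of_nat j ^ i) = 0"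
    and moment_m: "(\<Sum>j\<le>k. w j * of_nat j ^ m) = c"
    and p: "p < m" and N: "Suc p + r \<le> N"
    and f: "\<And>v. p < v \<Longrightarrow> v < Suc p + r \<Longrightarrow> f v = 0"
  shows "(\<lambda>n. of_nat n ^ Suc (r + m) * (\<Sum>j\<le>k. w j * of_nat (n + j) ^ p * (\<Sum>v\<le>N. f v / of_nat (n + j) ^ v)))
           \<longlonglongrightarrow> f (Suc p + r) * (- 1) ^ m * of_nat ((r + m) choose r) * c"
proof -
  let ?c = "f (Suc p + r) * (- 1) ^ m * of_nat ((r + m) choose r) * c"
  let ?t = "\<lambda>v n. f v * (of_nat n ^ Suc (r + m) * (\<Sum>j\<le>k. w j * of_nat (n + j) ^ p / of_nat (n + j) ^ v)) :: complex"
  \<comment> \<open>The moment limit with \<open>d = m\<close>: no power of \<open>j\<close> is left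
    in the summand, and \<open>n + j\<close> has the net exponent \<open>- Suc q\<close>.\<close>
  have lim: "(\<lambda>n. of_nat n ^ Suc (q + m) * (\<Sum>j\<le>k. w j * of_nat (n + j) ^ p / of_nat (n + j) ^ (Suc p + q)))
      \<longlonglongrightarrow> (- 1) ^ m * of_nat ((q + m) choose q) * c" for q
  proof -
    have "(q + m) choose q = (q + m) choose m"
      using binomial_symmetric[of q "q + m"] by simp
    then have "(\<lambda>n. of_nat n ^ Suc (q + m) * (\<Sum>j\<le>k. w j / of_nat (n + j) ^ Suc q))
        \<longlonglongrightarrow> (- 1) ^ m * of_nat ((q + m) choose q) * c"
      using sum_moment_inverse_power_tendsto[OF moments_0 moment_m, where d = m and q = "Suc q"] by simp
    then show ?thesis
    proof (rule Lim_transform_eventually)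
      show "\<forall>\<^sub>F n in sequentially. of_nat n ^ Suc (q + m) * (\<Sum>j\<le>k. w j / of_nat (n + j) ^ Suc q)
         = of_nat n ^ Suc (q + m) * (\<Sum>j\<le>k. w j * of_nat (n + j) ^ p / of_nat (n + j) ^ (Suc p + q))"
        using eventually_gt_at_top[of 0]
      proof eventually_elim
        case (elim n)
        have nz: "of_nat (n + j) \<noteq> (0::complex)" for j
          using elim by (metis add_gr_0 of_nat_eq_0_iff less_numeral_extra(3))
        have "w j / of_nat (n + j) ^ Suc q = w j * of_nat (n + j) ^ p / of_nat (n + j) ^ (Suc p + q)" for j
          using nz[of j] by (simp add: field_simps power_add del: of_nat_add)
        then show ?case by (simp del: of_nat_add)
      qed
    qed
  qed
  have summand: "?t v \<longlonglongrightarrow> (if v = Suc p + r then ?c else 0)" if v: "v \<le> N" for v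
  proof -
    consider "v \<le> p" | "p < v" "v < Suc p + r" | "v = Suc p + r" | "v > Suc p + r" by linarith
    then show ?thesis
    proof cases
      case 1
      have "\<forall>\<^sub>F n in sequentially. 0 = ?t v n"
        using eventually_gt_at_top[of 0]
      proof eventually_elim
        case (elim n)
        have nz: "of_nat (n + j) \<noteq> (0::complex)" for j
          using elim by (metis add_gr_0 of_nat_eq_0_iff less_numeral_extra(3))
        have "w j * of_nat (n + j) ^ p / of_nat (n + j) ^ v = w j * (of_nat j + of_nat n) ^ (p - v)" for j
          using nz[of j] 1 by (simp add: power_diff add.commute)
        moreover have "(\<Sum>j\<le>k. w j * (of_nat j + of_nat n) ^ (p - v)) = 0"
          using p by (intro sum_shifted_power_eq_0[OF moments_0]) auto
        ultimately show ?case by simp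
      qed
      then show ?thesis using 1 by (auto intro: Lim_transform_eventually[OF tendsto_const])
    next
      case 2
      then show ?thesis using f by simp
    next
      case 3
      then show ?thesis using tendsto_mult_left[OF lim[of r], of "f v"] by (simp add: mult_ac del: of_nat_add)
    next
      case 4
      \<comment> \<open>The distance from the leading index. The limit at \<open>r + d\<close>
        normalizes by \<open>d\<close> more factors \<open>n\<close> than the claim does, so the
        term itself tends to 0.\<close>
      define d where "d = v - Suc p - r"
      have d: "v = Suc p + (r + d)" "d > 0" using 4 by (auto simp: d_def)
      have "(\<lambda>n. (1 / of_nat n) ^ d :: complex) \<longlonglongrightarrow> 0 ^ d"
        by (intro tendsto_power lim_1_over_n)
      then have "(\<lambda>n. (1 / of_nat n) ^ d * (f v * (of_nat n ^ Suc (r + d + m)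
          * (\<Sum>j\<le>k. w j * of_nat (n + j) ^ p / of_nat (n + j) ^ v)))) \<longlonglongrightarrow> 0 ^ d * (f v * ((- 1) ^ m * of_nat ((r + d + m) choose (r + d)) * c))"
        unfolding d(1) by (intro tendsto_mult tendsto_const lim)
      moreover have "\<forall>\<^sub>F n in sequentially. (1 / of_nat n) ^ d * (f v * (of_nat n ^ Suc (r + d + m)
          * (\<Sum>j\<le>k. w j * of_nat (n + j) ^ p / of_nat (n + j) ^ v))) = ?t v n"
        using eventually_gt_at_top[of 0]
        by eventually_elim (simp add: power_divide power_add field_simps)
      ultimately have "?t v \<longlonglongrightarrow> 0 ^ d * (f v * ((- 1) ^ m * of_nat ((r + d + m) choose (r + d)) * c))"
        by (rule Lim_transform_eventually)
      then show ?thesis using d by (simp add: power_0_left del: power_Suc of_nat_add of_nat_mult)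
    qed
  qed
  have "(\<lambda>n. \<Sum>v\<le>N. ?t v n) \<longlonglongrightarrow> (\<Sum>v\<le>N. if v = Suc p + r then ?c else 0)"
    by (intro tendsto_sum summand) auto
  also have "(\<Sum>v\<le>N. if v = Suc p + r then ?c else 0) = ?c"
    using N by simp
  also have "(\<lambda>n. \<Sum>v\<le>N. ?t v n) = (\<lambda>n. of_nat n ^ Suc (r + m) * (\<Sum>j\<le>k. w j * of_nat (n + j) ^ p * (\<Sum>v\<le>N. f v / of_nat (n + j) ^ v)))"
    by (simp add: sum_distrib_left sum.swap[of _ "{..k}"] mult_ac)
  finally show ?thesis .
qed

section \<open>Multiplication of truncated expansions\<close>

lemma polynomial_bigo_1:
  fixes y :: "'a \<Rightarrow> complex"
  assumes "(y \<longlongrightarrow> 0) F"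
  shows "(\<lambda>x. \<Sum>t\<le>N. a t * y x ^ t) \<in> O[F](\<lambda>_. 1)"
proof (rule bigoI_tendsto)
  show "((\<lambda>x. (\<Sum>t\<le>N. a t * y x ^ t) / 1) \<longlongrightarrow> (\<Sum>t\<le>N. a t * 0 ^ t) / 1) F"
    by (intro tendsto_intros assms) auto
qed simp

text \<open>The full product runs over a square of index pairs, the Cauchy product over the triangle
  \<open>q + t \<le> N\<close>. Every pair in the difference carries a power of \<open>y\<close>
  beyond \<open>N\<close>, and \<open>y\<close> tends to 0.\<close>

lemma truncated_cauchy_product:
  fixes y :: "'a \<Rightarrow> complex" and a b :: "nat \<Rightarrow> complex"
  assumes y: "(y \<longlongrightarrow> 0) F"
  shows "(\<lambda>x. (\<Sum>t\<le>N. a t * y x ^ t) * (\<Sum>q\<le>N. b q * y x ^ q)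
            - (\<Sum>v\<le>N. (\<Sum>q\<le>v. a (v - q) * b q) * y x ^ v)) \<in> o[F](\<lambda>x. y x ^ N)"
proof -
  let ?g = "\<lambda>q t x. a t * b q * y x ^ (q + t)"
  let ?A = "{..N} \<times> {..N}" and ?T = "{(q, t). q + t \<le> N}"
  have prod: "(\<Sum>t\<le>N. a t * y x ^ t) * (\<Sum>q\<le>N. b q * y x ^ q) = (\<Sum>(q, t)\<in>?A. ?g q t x)" for x
    by (subst mult.commute, subst sum_product, subst sum.cartesian_product)
      (simp add: power_add mult_ac)
  have "(\<Sum>v\<le>N. (\<Sum>q\<le>v. a (v - q) * b q) * y x ^ v) = (\<Sum>v\<le>N. \<Sum>q\<le>v. ?g q (v - q) x)" for x
    by (simp add: sum_distrib_right)
  also have "\<dots> x = (\<Sum>(q, t)\<in>?T. ?g q t x)" for x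
    by (rule sum.triangle_reindex_eq[symmetric])
  finally have tri: "(\<Sum>v\<le>N. (\<Sum>q\<le>v. a (v - q) * b q) * y x ^ v) = (\<Sum>(q, t)\<in>?T. ?g q t x)" for x .
  have "?T \<subseteq> ?A" by auto
  then have diff: "(\<Sum>(q, t)\<in>?A. ?g q t x) - (\<Sum>(q, t)\<in>?T. ?g q t x) = (\<Sum>(q, t)\<in>?A - ?T. ?g q t x)" for x
    by (simp add: sum_diff)
  have "(\<lambda>x. \<Sum>i\<in>?A - ?T. case i of (q, t) \<Rightarrow> ?g q t x) \<in> o[F](\<lambda>x. y x ^ N)"
  proof (rule big_sum_in_smallo)
    fix i assume i: "i \<in> ?A - ?T"
    obtain q t where [simp]: "i = (q, t)" by force
    define d where "d = q + t - N"
    have d: "q + t = N + d" "d > 0" using i by (auto simp: d_def)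
    have "(\<lambda>x. y x ^ d) \<in> o[F](\<lambda>_. 1)"
      using tendsto_power[OF y, of d] d(2) by (intro smalloI_tendsto) (auto simp: power_0_left)
    then have "(\<lambda>x. a t * b q * y x ^ N * y x ^ d) \<in> o[F](\<lambda>x. y x ^ N * 1)"
      by (intro landau_o.big_small_mult) auto
    then show "(\<lambda>x. case i of (q, t) \<Rightarrow> ?g q t x) \<in> o[F](\<lambda>x. y x ^ N)"
      by (simp add: d(1) mult.assoc flip: power_add)
  qed
  then show ?thesis
    unfolding prod tri diff .
qed

text \<open>The error splits into three parts: the error of \<open>A\<close> times the main part of
  \<open>X\<close>, then \<open>A\<close> times the error of \<open>X\<close>, and the truncation
  error of the Cauchy products. \<open>V\<close> is a common majorant of the factors
  \<open>Z l\<close>, so that none of them has to dominate the others.\<close>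

lemma product_expansion:
  fixes y A V X :: "'a \<Rightarrow> complex" and Z :: "'i \<Rightarrow> 'a \<Rightarrow> complex"
  assumes y: "(y \<longlongrightarrow> 0) F"
    and A: "(\<lambda>x. A x - L * (\<Sum>t\<le>N. e t * y x ^ t)) \<in> o[F](\<lambda>x. y x ^ N)"
    and X: "(\<lambda>x. X x - (\<Sum>l\<in>I. Z l x * (\<Sum>q\<le>N. c l q * y x ^ q))) \<in> o[F](\<lambda>x. V x * y x ^ N)"
    and Z: "\<And>l. l \<in> I \<Longrightarrow> Z l \<in> O[F](V)"
  shows "(\<lambda>x. A x * X x - L * (\<Sum>l\<in>I. Z l x * (\<Sum>v\<le>N. (\<Sum>q\<le>v. e (v - q) * c l q) * y x ^ v)))
           \<in> o[F](\<lambda>x. V x * y x ^ N)"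
proof -
  let ?E = "\<lambda>x. \<Sum>t\<le>N. e t * y x ^ t"
  let ?C = "\<lambda>l x. \<Sum>q\<le>N. c l q * y x ^ q"
  let ?F = "\<lambda>l x. \<Sum>v\<le>N. (\<Sum>q\<le>v. e (v - q) * c l q) * y x ^ v"
  let ?B = "\<lambda>x. \<Sum>l\<in>I. Z l x * ?C l x"
  \<comment> \<open>The indicator of \<open>t = N\<close> as coefficient sequence turns the
    polynomial into a single power. With it the error of \<open>A\<close> is bounded, and hence so
    is \<open>A\<close>.\<close>
  have yN: "(\<lambda>x. y x ^ N) \<in> O[F](\<lambda>_. 1)"
    using polynomial_bigo_1[OF y, where N = N and a = "\<lambda>t. if t = N then 1 else 0"]
    by (simp add: if_distrib[of "\<lambda>x. x * _"] cong: if_cong)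
  have "(\<lambda>x. (A x - L * ?E x) + L * ?E x) \<in> O[F](\<lambda>_. 1)"
    using polynomial_bigo_1[OF y, where N = N and a = e] landau_o.big.trans[OF landau_o.small_imp_big[OF A] yN]
    by (intro sum_in_bigo(1)) auto
  then have A1: "A \<in> O[F](\<lambda>_. 1)" by simp
  have "(\<lambda>x. Z l x * ?C l x) \<in> O[F](\<lambda>x. V x * 1)" if "l \<in> I" for l
    using that by (intro landau_o.big_mult Z polynomial_bigo_1 y)
  then have B: "?B \<in> O[F](V)"
    by (intro big_sum_in_bigo) simp
  have 1: "(\<lambda>x. (A x - L * ?E x) * ?B x) \<in> o[F](\<lambda>x. V x * y x ^ N)"
    using landau_o.small_big_mult[OF A B] by (simp add: mult.commute)
  have 2: "(\<lambda>x. A x * (X x - ?B x)) \<in> o[F](\<lambda>x. V x * y x ^ N)"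
    using landau_o.big_small_mult[OF A1 X] by simp
  have "(\<lambda>x. Z l x * (?E x * ?C l x - ?F l x)) \<in> o[F](\<lambda>x. V x * y x ^ N)" if "l \<in> I" for l
    using that by (intro landau_o.big_small_mult Z truncated_cauchy_product y)
  then have 3: "(\<lambda>x. L * (\<Sum>l\<in>I. Z l x * (?E x * ?C l x - ?F l x))) \<in> o[F](\<lambda>x. V x * y x ^ N)"
    using big_sum_in_smallo[of I "\<lambda>l x. Z l x * (?E x * ?C l x - ?F l x)"] by simp
  have "(\<lambda>x. (A x - L * ?E x) * ?B x + A x * (X x - ?B x)
       + L * (\<Sum>l\<in>I. Z l x * (?E x * ?C l x - ?F l x))) \<in> o[F](\<lambda>x. V x * y x ^ N)"
    by (intro sum_in_smallo 1 2 3)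
  moreover have "(A x - L * ?E x) * ?B x + A x * (X x - ?B x)
       + L * (\<Sum>l\<in>I. Z l x * (?E x * ?C l x - ?F l x))
      = A x * X x - L * (\<Sum>l\<in>I. Z l x * ?F l x)" for x
  proof -
    have "L * (\<Sum>l\<in>I. Z l x * (?E x * ?C l x - ?F l x)) = L * ?E x * ?B x - L * (\<Sum>l\<in>I. Z l x * ?F l x)"
      by (simp add: right_diff_distrib sum_subtractf sum_distrib_left mult_ac)
    then show ?thesis by (simp add: algebra_simps)
  qed
  ultimately show ?thesis by simp
qed

text \<open>After a shift of the error expansion by \<open>j\<close>, both expansions are in powers
  of \<open>1 / (n + j)\<close> and can be multiplied. Summing over \<open>j\<close> groups the
  result by zeroes, because \<open>\<zeta> l ^ (n + j)\<close> splits into a factor depending on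
  \<open>n\<close> and a weight \<open>\<zeta> l ^ j\<close>.\<close>

lemma transformed_sum_expansion:
  fixes I :: "'i set" and \<zeta> :: "'i \<Rightarrow> complex" and b :: "nat \<Rightarrow> complex"
  defines "V \<equiv> \<lambda>n. complex_of_real (\<Sum>l\<in>I. norm (\<zeta> l) ^ n)"
  assumes "finite I"
    and lam: "\<And>j. j \<le> k \<Longrightarrow> (\<lambda>n. lam n j * (of_nat n ^ p / of_nat (n + j) ^ p)
          - lam0 j * (\<Sum>t\<le>N. e t * (1 / of_nat (n + j)) ^ t)) \<in> o(\<lambda>n. (1 / of_nat (n + j)) ^ N)"
    and b: "(\<lambda>n. b n - (\<Sum>l\<in>I. \<zeta> l ^ n * (\<Sum>q\<le>N. c l q * (1 / of_nat n) ^ q)))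
          \<in> o(\<lambda>n. V n * (1 / of_nat n) ^ N)"
    and f: "\<And>l v. l \<in> I \<Longrightarrow> f l v = (\<Sum>q\<le>v. e (v - q) * c l q)"
  shows "(\<lambda>n. of_nat n ^ p * (\<Sum>j\<le>k. lam n j * b (n + j))
            - (\<Sum>l\<in>I. \<zeta> l ^ n * (\<Sum>j\<le>k. lam0 j * \<zeta> l ^ j * of_nat (n + j) ^ p
                 * (\<Sum>v\<le>N. f l v / of_nat (n + j) ^ v))))
          \<in> o(\<lambda>n. of_nat n ^ p * V n / of_nat n ^ N)"
proof -
  let ?y = "\<lambda>j n. 1 / of_nat (n + j) :: complex"
  let ?A = "\<lambda>j n. lam n j * (of_nat n ^ p / of_nat (n + j) ^ p)"
  let ?F = "\<lambda>j n. \<Sum>l\<in>I. \<zeta> l ^ (n + j) * (\<Sum>v\<le>N. f l v * ?y j n ^ v)"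
  have shift: "filterlim (\<lambda>n. n + j) sequentially sequentially" for j :: nat
    by (rule filterlim_add_const_nat_at_top)
  have main: "(\<lambda>n. of_nat (n + j) ^ p * (?A j n * b (n + j) - lam0 j * ?F j n))
      \<in> o(\<lambda>n. of_nat n ^ p * V n / of_nat n ^ N)" if j: "j \<le> k" for j
  proof -
    have "?y j \<longlonglongrightarrow> 0"
      using filterlim_compose[OF lim_1_over_n shift] .
    moreover have "(\<lambda>n. b (n + j) - (\<Sum>l\<in>I. \<zeta> l ^ (n + j) * (\<Sum>q\<le>N. c l q * ?y j n ^ q)))
        \<in> o(\<lambda>n. V (n + j) * ?y j n ^ N)"
      using landau_o.small.compose[OF b shift] .
    moreover have "(\<lambda>n. \<zeta> l ^ (n + j)) \<in> O(\<lambda>n. V (n + j))" if "l \<in> I" for l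
      using that \<open>finite I\<close>
      by (intro landau_o.big_mono always_eventually)
        (auto simp: V_def norm_power sum_nonneg simp del: of_real_sum intro!: member_le_sum)
    ultimately have "(\<lambda>n. ?A j n * b (n + j) - lam0 j * (\<Sum>l\<in>I. \<zeta> l ^ (n + j)
          * (\<Sum>v\<le>N. (\<Sum>q\<le>v. e (v - q) * c l q) * ?y j n ^ v))) \<in> o(\<lambda>n. V (n + j) * ?y j n ^ N)"
      by (intro product_expansion lam j) auto
    then have "(\<lambda>n. ?A j n * b (n + j) - lam0 j * ?F j n) \<in> o(\<lambda>n. V (n + j) * ?y j n ^ N)"
      by (simp add: f)
    then have "(\<lambda>n. of_nat (n + j) ^ p * (?A j n * b (n + j) - lam0 j * ?F j n))
        \<in> o(\<lambda>n. of_nat (n + j) ^ p * (V (n + j) * ?y j n ^ N))"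
      by (rule landau_o.small.mult_left)
    \<comment> \<open>A shift by a fixed \<open>j\<close> changes each factor of the scale by at
      most a constant factor; for \<open>V\<close> this constant is the sum of the
      \<open>norm (\<zeta> l) ^ j\<close>.\<close>
    moreover have "(\<lambda>n. of_nat (n + j) ^ p * (V (n + j) * ?y j n ^ N)) \<in> O(\<lambda>n. of_nat n ^ p * (V n * (1 / of_nat n) ^ N))"
    proof (intro landau_o.big_mult landau_o.big_power)
      show "(\<lambda>n. of_nat (n + j)) \<in> O(\<lambda>n. of_nat n :: complex)"
      proof (rule bigoI)
        show "\<forall>\<^sub>F n in sequentially. norm (of_nat (n + j) :: complex) \<le> (1 + real j) * norm (of_nat n :: complex)"
          using eventually_ge_at_top[of 1]
        proof eventually_elim
          case (elim n)
          then have "real j * 1 \<le> real j * real n" by (intro mult_left_mono) auto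
          then show ?case unfolding norm_of_nat by (simp add: algebra_simps)
        qed
      qed
      show "?y j \<in> O(\<lambda>n. 1 / of_nat n)"
      proof (rule landau_o.big_mono)
        show "\<forall>\<^sub>F n in sequentially. norm (?y j n) \<le> norm (1 / of_nat n :: complex)"
          using eventually_ge_at_top[of 1]
          by eventually_elim (simp add: norm_divide frac_le del: of_nat_add)
      qed
      have "norm (\<zeta> l) ^ (n + j) \<le> (\<Sum>l\<in>I. norm (\<zeta> l) ^ j) * norm (\<zeta> l) ^ n" if "l \<in> I" for l n
        using that \<open>finite I\<close> unfolding power_add
        by (subst mult.commute) (auto intro!: mult_right_mono member_le_sum)
      then have "(\<Sum>l\<in>I. norm (\<zeta> l) ^ (n + j)) \<le> (\<Sum>l\<in>I. norm (\<zeta> l) ^ j) * (\<Sum>l\<in>I. norm (\<zeta> l) ^ n)" for n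
        unfolding sum_distrib_left[of "\<Sum>l\<in>I. norm (\<zeta> l) ^ j"] by (intro sum_mono) auto
      then show "(\<lambda>n. V (n + j)) \<in> O(V)"
        by (intro bigoI[where c = "\<Sum>l\<in>I. norm (\<zeta> l) ^ j"] always_eventually)
          (simp add: V_def sum_nonneg del: of_real_sum)
    qed
    ultimately show ?thesis
      using landau_o.small_big_trans by (fastforce simp: power_divide)
  qed
  have "(\<lambda>n. \<Sum>j\<le>k. of_nat (n + j) ^ p * (?A j n * b (n + j) - lam0 j * ?F j n))
      \<in> o(\<lambda>n. of_nat n ^ p * V n / of_nat n ^ N)"
    by (rule big_sum_in_smallo) (use main in auto)
  \<comment> \<open>For \<open>n > 0\<close> the factor \<open>(n + j) ^ p\<close> cancels the
    denominator in \<open>?A\<close>, so \<open>n ^ p\<close> can be taken out of the sum over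
    \<open>j\<close>.\<close>
  moreover have "\<forall>\<^sub>F n in sequentially. (\<Sum>j\<le>k. of_nat (n + j) ^ p * (?A j n * b (n + j) - lam0 j * ?F j n))
    = of_nat n ^ p * (\<Sum>j\<le>k. lam n j * b (n + j))
            - (\<Sum>l\<in>I. \<zeta> l ^ n * (\<Sum>j\<le>k. lam0 j * \<zeta> l ^ j * of_nat (n + j) ^ p
                 * (\<Sum>v\<le>N. f l v / of_nat (n + j) ^ v)))"
    using eventually_gt_at_top[of 0]
  proof eventually_elim
    case (elim n)
    have nz: "of_nat (n + j) \<noteq> (0::complex)" for j
      using elim by (metis add_gr_0 of_nat_eq_0_iff less_numeral_extra(3))
    have "of_nat (n + j) ^ p * (?A j n * b (n + j)) = of_nat n ^ p * (lam n j * b (n + j))" for j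
      using nz[of j] by (simp add: field_simps del: of_nat_add)
    moreover have "of_nat (n + j) ^ p * (lam0 j * ?F j n) = (\<Sum>l\<in>I. \<zeta> l ^ n * (lam0 j * \<zeta> l ^ j * of_nat (n + j) ^ p
                 * (\<Sum>v\<le>N. f l v / of_nat (n + j) ^ v)))" for j
      by (simp add: sum_distrib_left power_divide power_add mult_ac del: of_nat_add)
    ultimately show ?case
      unfolding right_diff_distrib sum_subtractf
      by (simp add: sum_distrib_left sum.swap[of _ "{..k}" I] del: of_nat_add)
  qed
  ultimately show ?thesis
    by (rule landau_o.small.in_cong[THEN iffD1, rotated])
qed

theorem theorem10:
  fixes K :: "complex set"
    and k M :: nat
    and lam :: "nat \<Rightarrow> nat \<Rightarrow> complex"
    and lam0 :: "nat \<Rightarrow> complex"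
    and P :: "complex poly"
    and \<zeta> :: "nat \<Rightarrow> complex"
    and m :: "nat \<Rightarrow> nat"
    and e :: "nat \<Rightarrow> complex"
    and S \<omega> :: "nat \<Rightarrow> complex"
    and s :: complex
    and c f :: "nat \<Rightarrow> nat \<Rightarrow> complex"
    and r :: "nat \<Rightarrow> nat"
    and B :: "nat \<Rightarrow> complex"
    and \<rho> :: complex
    and g :: "nat \<Rightarrow> nat \<Rightarrow> complex"
  assumes K: "K = \<real> \<or> K = UNIV"
    and k: "k \<ge> 1"
    and lam: "coefficient_set K k lam"
    and lim: "limiting_coefficients k lam lam0"
    and P: "P = characteristic_poly k lam0"
    and factorization: "P = (\<Prod>l=1..M. [:- \<zeta> l, 1:] ^ m l)"
    and zeroes_distinct: "inj_on \<zeta> {1..M}"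
    and zeroes_nonzero: "\<forall>l\<in>{1..M}. \<zeta> l \<noteq> 0"
    and multiplicities_pos: "\<forall>l\<in>{1..M}. m l \<ge> 1"
    and multiplicities_mono: "mono_on {1..M} m"
    and e0: "e 0 = 1"
    and lam_expansion:
      "\<forall>j\<le>k. inverse_power_expansion
          (\<lambda>n. lam n j * (of_nat n ^ (m 1 - 1) / of_nat (n + j) ^ (m 1 - 1)))
          (\<lambda>n. of_nat (n + j)) (\<lambda>t. lam0 j * e t)"
    and dom: "levin_domain K k lam S \<omega>"
    and s: "s \<in> K"
    and S_expansion: "exp_power_expansion (\<lambda>n. (S n - s) / \<omega> n) {1..M} \<zeta> c"
    and f: "\<forall>l\<in>{1..M}. \<forall>v. f l v = (\<Sum>q\<le>v. e (v - q) * c l q)"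
    and r_exists: "\<forall>l\<in>{1..M}. \<exists>q. f l (q + m 1) \<noteq> 0"
    and r: "\<forall>l\<in>{1..M}. r l = (LEAST q. f l (q + m 1) \<noteq> 0)"
    and B: "\<forall>l\<in>{1..M}. B l = (- 1) ^ m l * poly ((pderiv ^^ m l) P) (\<zeta> l)"
    and rho: "(\<lambda>n. \<omega> (Suc n) / \<omega> n) \<longlonglongrightarrow> \<rho>"
    and rho_nonzero: "\<rho> \<noteq> 0"
    and rho_zeroes: "\<rho> \<notin> (\<lambda>l. inverse (\<zeta> l)) ` {1..M}"
    and g: "\<forall>l\<in>{1..M}. \<forall>n. g l n = f l (r l + m 1) * \<zeta> l ^ (n + m l)
              * of_nat ((r l + m l) choose r l) * (B l / of_nat n ^ (r l + m l - m 1))"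
  shows
    "asymp_equiv_sum sequentially (\<lambda>n. (levin_transform k lam S \<omega> n - s) / \<omega> n)
       {1..M} (\<lambda>l n. g l n / poly P (1 / \<rho>) * (1 / of_nat n ^ (2 * m 1)))
     \<and> (\<forall>F\<le>sequentially. noncancelling F {1..M} g \<longrightarrow>
         (\<lambda>n. (levin_transform k lam S \<omega> n - s) / \<omega> n)
           \<sim>[F] (\<lambda>n. (\<Sum>l=1..M. g l n) / poly P (1 / \<rho>) * (1 / of_nat n ^ (2 * m 1))))
     \<and> ((\<forall>l\<in>{1..M}. c l 0 \<noteq> 0) \<longrightarrow>
         (\<exists>\<tau>\<ge>0. \<forall>F\<le>sequentially. noncancelling F {1..M} (\<lambda>l n. \<zeta> l ^ n * c l 0) \<longrightarrow>
           (\<lambda>n. norm ((levin_transform k lam S \<omega> n - s) / (S n - s)))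
             \<in> O[F](\<lambda>n. real n powr (- real (2 * m 1) - \<tau>))))"
proof -

  \<comment> \<open>Abbreviations and nonvanishing of the limiting denominator\<close>
  define p where "p = m 1 - 1"
  define P0 where "P0 = poly P (1 / \<rho>)"
  define W where "W = (\<lambda>n. \<Sum>l=1..M. norm (\<zeta> l) ^ n)"
  define b where "b = (\<lambda>n. (S n - s) / \<omega> n)"
  define X where "X = (\<lambda>n. (levin_transform k lam S \<omega> n - s) / \<omega> n)"
  \<comment> \<open>\<open>h l\<close> is the expected leading contribution of
    \<open>\<zeta> l\<close> to the numerator. Errors are measured against \<open>H\<close>, because
    the \<open>h l\<close> may cancel in their sum.\<close>
  define h where "h = (\<lambda>l n. g l n / of_nat n ^ (2 * m 1))"
  define H where "H = (\<lambda>n. \<Sum>l=1..M. norm (h l n))"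

  have omega_nz: "\<omega> n \<noteq> 0" and den_nz: "(\<Sum>j\<le>k. lam n j / \<omega> (n + j)) \<noteq> 0" for n
    using dom by (auto simp: levin_domain_def)
  have P_sum: "P = (\<Sum>j\<le>k. monom (lam0 j) j)"
    using P by (simp add: characteristic_poly_def)
  \<comment> \<open>With no zeroes the product is the constant 1, whose coefficient at
    \<open>k \<ge> 1\<close> is 0, unlike \<open>lam0 k\<close>.\<close>
  have M: "M \<ge> 1"
  proof (rule ccontr)
    assume "\<not> M \<ge> 1"
    then have "coeff P k = 0" using factorization k by simp
    moreover have "coeff P k = lam0 k" by (simp add: P_sum coeff_sum)
    ultimately show False using lim by (simp add: limiting_coefficients_def)
  qed
  have m1: "m 1 = Suc p"
    using multiplicities_pos M by (force simp: p_def)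
  have m1_le: "m 1 \<le> m l" if "l \<in> {1..M}" for l
    using that M by (intro mono_onD[OF multiplicities_mono]) auto
  have P0: "P0 \<noteq> 0"
  proof -
    have "1 / \<rho> - \<zeta> l \<noteq> 0" if "l \<in> {1..M}" for l
    proof
      assume "1 / \<rho> - \<zeta> l = 0"
      then have "\<zeta> l = inverse \<rho>" by (simp add: inverse_eq_divide)
      then have "\<rho> = inverse (\<zeta> l)" by simp
      then show False using rho_zeroes that by blast
    qed
    then show ?thesis
      by (auto simp: P0_def factorization poly_prod)
  qed

  \<comment> \<open>Moments at the zeroes of the characteristic polynomial\<close>
  have root: "\<exists>Q. P = [:- \<zeta> l, 1:] ^ m l * Q \<and> poly Q (\<zeta> l) \<noteq> 0" if "l \<in> {1..M}" for l
  proof (intro exI conjI)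
    show "P = [:- \<zeta> l, 1:] ^ m l * (\<Prod>i\<in>{1..M} - {l}. [:- \<zeta> i, 1:] ^ m i)"
      using prod.remove[OF finite_atLeastAtMost that, of "\<lambda>i. [:- \<zeta> i, 1:] ^ m i"]
      by (simp only: factorization)
    have "\<zeta> l - \<zeta> i \<noteq> 0" if "i \<in> {1..M} - {l}" for i
      using inj_onD[OF zeroes_distinct, of l i] that \<open>l \<in> {1..M}\<close> by auto
    then show "poly (\<Prod>i\<in>{1..M} - {l}. [:- \<zeta> i, 1:] ^ m i) (\<zeta> l) \<noteq> 0"
      by (simp add: poly_prod)
  qed
  have moments: "(\<Sum>j\<le>k. lam0 j * \<zeta> l ^ j * of_nat j ^ i)
      = (if i < m l then 0 else (- 1) ^ m l * \<zeta> l ^ m l * B l)"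
    and B_nz: "B l \<noteq> 0" if l: "l \<in> {1..M}" and i: "i \<le> m l" for l i
  proof -
    obtain Q where Q: "P = [:- \<zeta> l, 1:] ^ m l * Q" "poly Q (\<zeta> l) \<noteq> 0"
      using root[OF l] by blast
    \<comment> \<open>The cofactor does not vanish at \<open>\<zeta> l\<close>, as the zeroes are
      distinct; therefore neither does \<open>B l\<close>.\<close>
    have B_Q: "B l = (- 1) ^ m l * (fact (m l) * poly Q (\<zeta> l))"
      using B l poly_funpow_pderiv_root[of "m l" "\<zeta> l" Q] by (simp add: Q(1))
    show "(\<Sum>j\<le>k. lam0 j * \<zeta> l ^ j * of_nat j ^ i)
      = (if i < m l then 0 else (- 1) ^ m l * \<zeta> l ^ m l * B l)"
      using moments_root[OF P_sum[symmetric, unfolded Q(1)] i]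
      by (simp add: B_Q mult_ac flip: power_mult_distrib)
    show "B l \<noteq> 0"
      using Q(2) by (simp add: B_Q)
  qed

  \<comment> \<open>Truncation order and leading terms\<close>
  \<comment> \<open>A sum serves as an upper bound for all \<open>r l + m l + m 1\<close>, the
    exponents of \<open>1 / n\<close> in the leading terms.\<close>
  define N where "N = (\<Sum>l=1..M. r l + m l + m 1)"
  have N: "r l + m l + m 1 \<le> N" if "l \<in> {1..M}" for l
    unfolding N_def using that by (intro member_le_sum) auto
  have f_r: "f l (r l + m 1) \<noteq> 0" and f_below: "\<And>q. q < r l \<Longrightarrow> f l (q + m 1) = 0" if "l \<in> {1..M}" for l
    using LeastI_ex[OF r_exists[rule_format, OF that]] not_less_Least[of _ "\<lambda>q. f l (q + m 1) \<noteq> 0"]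
      r that by auto
  define G where "G = (\<lambda>l. f l (r l + m 1) * of_nat ((r l + m l) choose r l) * \<zeta> l ^ m l * B l)"
  have G_nz: "G l \<noteq> 0" if "l \<in> {1..M}" for l
    using f_r[OF that] B_nz[OF that order_refl] zeroes_nonzero that by (auto simp: G_def binomial_eq_0_iff)
  have h_eq: "h l n = \<zeta> l ^ n * G l / of_nat n ^ (r l + m l + m 1)" if l: "l \<in> {1..M}" for l n
  proof -
    \<comment> \<open>The subtraction in the exponent of \<open>g\<close> does not truncate, since
      \<open>m 1\<close> is the least multiplicity.\<close>
    have "r l + m l + m 1 = (r l + m l - m 1) + 2 * m 1" using m1_le[OF l] by simp
    then show ?thesis
      using g l by (simp only: h_def G_def power_add) (simp add: mult_ac)
  qed
  have h_nz: "h l n \<noteq> 0" if "l \<in> {1..M}" "n > 0" for l n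
    using that G_nz zeroes_nonzero by (simp add: h_eq)

  \<comment> \<open>The contribution of \<open>\<zeta> l\<close> to \<open>n ^ p\<close> times the
    numerator, without the factor \<open>\<zeta> l ^ n\<close>.\<close>
  define D where "D = (\<lambda>l n. \<Sum>j\<le>k. lam0 j * \<zeta> l ^ j * of_nat (n + j) ^ p * (\<Sum>v\<le>N. f l v / of_nat (n + j) ^ v))"
  have D_lim: "(\<lambda>n. of_nat n ^ Suc (r l + m l) * D l n) \<longlonglongrightarrow> G l" if l: "l \<in> {1..M}" for l
  proof -
    have "(\<lambda>n. of_nat n ^ Suc (r l + m l) * D l n) \<longlonglongrightarrow> f l (Suc p + r l) * (- 1) ^ m l
        * of_nat ((r l + m l) choose r l) * ((- 1) ^ m l * \<zeta> l ^ m l * B l)"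
      unfolding D_def
    proof (rule annihilated_expansion_tendsto)
      show "(\<Sum>j\<le>k. lam0 j * \<zeta> l ^ j * of_nat j ^ i) = 0" if "i < m l" for i
        using moments[OF l, of i] that by simp
      show "(\<Sum>j\<le>k. lam0 j * \<zeta> l ^ j * of_nat j ^ m l) = (- 1) ^ m l * \<zeta> l ^ m l * B l"
        using moments[OF l, of "m l"] by simp
      show "p < m l" "Suc p + r l \<le> N"
        using m1_le[OF l] N[OF l] m1 by auto
      show "f l v = 0" if "p < v" "v < Suc p + r l" for v
        using f_below[OF l, of "v - m 1"] that m1 by auto
    qed
    \<comment> \<open>The sign from the inverse powers and the sign from writing the moment in terms
      of \<open>B l\<close> cancel.\<close>
    also have "f l (Suc p + r l) * (- 1) ^ m l * of_nat ((r l + m l) choose r l) * ((- 1) ^ m l * \<zeta> l ^ m l * B l)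
        = ((- 1) ^ m l * (- 1) ^ m l) * (f l (r l + Suc p) * of_nat ((r l + m l) choose r l) * \<zeta> l ^ m l * B l)"
      by (simp only: mult_ac add.commute[of "Suc p"])
    also have "\<dots> = G l"
      unfolding G_def m1 by (simp flip: power_mult_distrib)
    finally show ?thesis .
  qed

  \<comment> \<open>The numerator\<close>
  have num: "(\<lambda>n. (\<Sum>j\<le>k. lam n j * b (n + j)) - (\<Sum>l=1..M. h l n)) \<in> o(\<lambda>n. complex_of_real (H n))"
  proof -
    have "(\<lambda>n. of_nat n ^ p * (\<Sum>j\<le>k. lam n j * b (n + j)) - (\<Sum>l=1..M. \<zeta> l ^ n * D l n))
          \<in> o(\<lambda>n. of_nat n ^ p * complex_of_real (W n) / of_nat n ^ N)"
      unfolding D_def W_def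
    proof (rule transformed_sum_expansion)
      show "(\<lambda>n. lam n j * (of_nat n ^ p / of_nat (n + j) ^ p)
          - lam0 j * (\<Sum>t\<le>N. e t * (1 / of_nat (n + j)) ^ t)) \<in> o(\<lambda>n. (1 / of_nat (n + j)) ^ N)"
        if "j \<le> k" for j
        using lam_expansion[rule_format, OF that]
        by (simp add: inverse_power_expansion_def p_def sum_distrib_left power_divide mult.assoc)
      have "(\<lambda>n. norm (b n - (\<Sum>l=1..M. \<zeta> l ^ n * (\<Sum>q\<le>N. c l q / of_nat n ^ q))))
            \<in> o(\<lambda>n. W n / real n ^ N)"
        using S_expansion by (simp add: exp_power_expansion_def b_def W_def sum_divide_distrib)
      then show "(\<lambda>n. b n - (\<Sum>l=1..M. \<zeta> l ^ n * (\<Sum>q\<le>N. c l q * (1 / of_nat n) ^ q)))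
          \<in> o(\<lambda>n. complex_of_real (\<Sum>l=1..M. norm (\<zeta> l) ^ n) * (1 / of_nat n) ^ N)"
        by (simp add: norm_smallo_iff W_def power_divide)
    qed (use f in auto)
    \<comment> \<open>By the choice of \<open>N\<close>, and since no \<open>G l\<close> is 0, the
      remainder scale is at most a constant times the sum of the moduli of the leading
      terms.\<close>
    also have "(\<lambda>n. of_nat n ^ p * complex_of_real (W n) / of_nat n ^ N)
        \<in> O(\<lambda>n. of_nat n ^ p * complex_of_real (H n))"
      unfolding times_divide_eq_right[symmetric]
    proof (intro landau_o.big.mult_left bigoI)
      show "\<forall>\<^sub>F n in sequentially. norm (complex_of_real (W n) / of_nat n ^ N)
          \<le> (\<Sum>l=1..M. 1 / norm (G l)) * norm (complex_of_real (H n))"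
        using eventually_ge_at_top[of 1]
      proof eventually_elim
        case (elim n)
        have "norm (\<zeta> l) ^ n / real n ^ N \<le> (\<Sum>l=1..M. 1 / norm (G l)) * norm (h l n)" if l: "l \<in> {1..M}" for l
        proof -
          have "norm (\<zeta> l) ^ n / real n ^ N \<le> norm (\<zeta> l) ^ n / real n ^ (r l + m l + m 1)"
            using N[OF l] elim by (intro divide_left_mono power_increasing) auto
          also have "\<dots> = 1 / norm (G l) * norm (h l n)"
            using G_nz[OF l] by (simp add: h_eq[OF l] norm_divide norm_mult norm_power)
          also have "\<dots> \<le> (\<Sum>l=1..M. 1 / norm (G l)) * norm (h l n)"
            using l by (intro mult_right_mono member_le_sum) auto
          finally show ?thesis .
        qed
        then have "W n / real n ^ N \<le> (\<Sum>l=1..M. 1 / norm (G l)) * H n"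
          unfolding W_def H_def sum_divide_distrib sum_distrib_left[of "\<Sum>l=1..M. 1 / norm (G l)"]
          by (rule sum_mono)
        then show ?case
          by (simp add: norm_divide norm_power W_def H_def sum_nonneg del: of_real_sum)
      qed
    qed
    finally have 1: "(\<lambda>n. of_nat n ^ p * (\<Sum>j\<le>k. lam n j * b (n + j)) - (\<Sum>l=1..M. \<zeta> l ^ n * D l n))
        \<in> o(\<lambda>n. of_nat n ^ p * complex_of_real (H n))" .
    \<comment> \<open>For a single zero no cancellation can occur: \<open>h l n\<close> is nonzero
      for \<open>n > 0\<close>, and the limit of a quotient suffices.\<close>
    have "(\<lambda>n. \<zeta> l ^ n * D l n - of_nat n ^ p * h l n) \<in> o(\<lambda>n. of_nat n ^ p * complex_of_real (H n))"
      if l: "l \<in> {1..M}" for l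
    proof -
      have "(\<lambda>n. (\<zeta> l ^ n * D l n - of_nat n ^ p * h l n) / (of_nat n ^ p * h l n)) \<longlonglongrightarrow> 0"
      proof (rule Lim_transform_eventually)
        show "(\<lambda>n. (of_nat n ^ Suc (r l + m l) * D l n - G l) / G l) \<longlonglongrightarrow> 0"
          using tendsto_divide[OF tendsto_diff[OF D_lim[OF l] tendsto_const[of "G l"]] tendsto_const[of "G l"]]
            G_nz[OF l] by (simp del: power_Suc)
        show "\<forall>\<^sub>F n in sequentially. (of_nat n ^ Suc (r l + m l) * D l n - G l) / G l
            = (\<zeta> l ^ n * D l n - of_nat n ^ p * h l n) / (of_nat n ^ p * h l n)"
          using eventually_gt_at_top[of 0]
        proof eventually_elim
          case (elim n)
          \<comment> \<open>Used with \<open>x = n ^ Suc (r l + m l)\<close>,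
            \<open>z = \<zeta> l ^ n\<close>, \<open>d = D l n\<close> and
            \<open>a = G l\<close>.\<close>
          have alg: "(x * d - a) / a = (z * d - z * a / x) / (z * a / x)"
            if "x \<noteq> 0" "z \<noteq> 0" "a \<noteq> 0" for x z a d :: complex
            using that by (simp add: field_simps)
          have "of_nat n ^ p * h l n = \<zeta> l ^ n * G l / of_nat n ^ Suc (r l + m l)"
            using elim unfolding h_eq[OF l] m1 by (simp add: power_add)
          then show ?case
            using elim G_nz[OF l] zeroes_nonzero l by (simp only:) (intro alg, auto)
        qed
      qed
      then have "(\<lambda>n. \<zeta> l ^ n * D l n - of_nat n ^ p * h l n) \<in> o(\<lambda>n. of_nat n ^ p * h l n)"
        by (rule smalloI_tendsto)
          (use eventually_gt_at_top[of 0] in \<open>eventually_elim, use h_nz[OF l] in simp\<close>)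
      also have "h l \<in> O(\<lambda>n. complex_of_real (H n))"
        using l by (intro landau_o.big_mono always_eventually)
          (auto simp: H_def sum_nonneg intro!: member_le_sum simp del: of_real_sum)
      then have "(\<lambda>n. of_nat n ^ p * h l n) \<in> O(\<lambda>n. of_nat n ^ p * complex_of_real (H n))"
        by (rule landau_o.big.mult_left)
      finally show ?thesis .
    qed
    then have 2: "(\<lambda>n. \<Sum>l=1..M. \<zeta> l ^ n * D l n - of_nat n ^ p * h l n) \<in> o(\<lambda>n. of_nat n ^ p * complex_of_real (H n))"
      by (rule big_sum_in_smallo)
    have "(\<lambda>n. of_nat n ^ p * ((\<Sum>j\<le>k. lam n j * b (n + j)) - (\<Sum>l=1..M. h l n)))
        \<in> o(\<lambda>n. of_nat n ^ p * complex_of_real (H n))"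
      using sum_in_smallo(1)[OF 1 2] by (simp add: sum_subtractf sum_distrib_left right_diff_distrib)
    from landau_o.small.mult_left[OF this, of "\<lambda>n. 1 / of_nat n ^ p"] show ?thesis
    proof (rule landau_o.small.cong_ex[THEN iffD1, rotated -1])
      show "\<forall>\<^sub>F n in sequentially. 1 / of_nat n ^ p * (of_nat n ^ p * complex_of_real (H n)) = complex_of_real (H n)"
        using eventually_gt_at_top[of 0] by eventually_elim simp
      show "\<forall>\<^sub>F n in sequentially. 1 / of_nat n ^ p * (of_nat n ^ p * ((\<Sum>j\<le>k. lam n j * b (n + j)) - (\<Sum>l=1..M. h l n)))
          = (\<Sum>j\<le>k. lam n j * b (n + j)) - (\<Sum>l=1..M. h l n)"
        using eventually_gt_at_top[of 0] by eventually_elim simp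
    qed
  qed

  \<comment> \<open>The denominator and the transformed error\<close>
  define Q where "Q = (\<lambda>n. \<Sum>j\<le>k. lam n j * (\<omega> n / \<omega> (n + j)))"
  have Q_eq: "Q n = \<omega> n * (\<Sum>j\<le>k. lam n j / \<omega> (n + j))" for n
    by (simp add: Q_def sum_distrib_left mult_ac)
  have Q_nz: "Q n \<noteq> 0" for n
    using omega_nz den_nz by (simp add: Q_eq)
  have omega_ratio: "(\<lambda>n. \<omega> n / \<omega> (n + j)) \<longlonglongrightarrow> (1 / \<rho>) ^ j" for j
  proof (induction j)
    case 0
    then show ?case using omega_nz by simp
  next
    case (Suc j)
    have "(\<lambda>n. \<omega> (n + j) / \<omega> (Suc (n + j))) \<longlonglongrightarrow> 1 / \<rho>"
      using tendsto_inverse[OF LIMSEQ_ignore_initial_segment[OF rho, of j] rho_nonzero]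
      by (simp add: inverse_eq_divide)
    from tendsto_mult[OF this Suc] show ?case
      using omega_nz by simp
  qed
  have "Q \<longlonglongrightarrow> (\<Sum>j\<le>k. lam0 j * (1 / \<rho>) ^ j)"
    unfolding Q_def using lim
    by (intro tendsto_sum tendsto_mult omega_ratio) (auto simp: limiting_coefficients_def)
  then have Q_lim: "Q \<longlonglongrightarrow> P0"
    by (simp add: P0_def P_sum poly_sum poly_monom)
  \<comment> \<open>The transformation is a weighted mean with weights
    \<open>lam n j / \<omega> (n + j)\<close>, so \<open>s\<close> can be subtracted inside
    it.\<close>
  have X_eq: "X n = (\<Sum>j\<le>k. lam n j * b (n + j)) / Q n" for n
  proof -
    let ?d = "\<Sum>j\<le>k. lam n j / \<omega> (n + j)"
    have "(\<Sum>j\<le>k. lam n j * b (n + j)) = (\<Sum>j\<le>k. lam n j * S (n + j) / \<omega> (n + j)) - s * ?d"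
      by (simp add: b_def sum_distrib_left sum_subtractf right_diff_distrib diff_divide_distrib mult_ac)
    then have "levin_transform k lam S \<omega> n - s = (\<Sum>j\<le>k. lam n j * b (n + j)) / ?d"
      using den_nz[of n] by (simp add: levin_transform_def field_simps)
    then show ?thesis
      by (simp add: X_def Q_eq mult.commute)
  qed
  have sum_h: "(\<lambda>n. \<Sum>l=1..M. h l n) \<in> O(\<lambda>n. complex_of_real (H n))"
    by (intro landau_o.big_mono always_eventually)
      (auto simp: H_def sum_nonneg simp del: of_real_sum intro: norm_sum)
  \<comment> \<open>The error is split into the numerator error divided by \<open>Q n\<close> and
    the leading sum times \<open>1 / Q n - 1 / P0\<close>.\<close>
  have X: "(\<lambda>n. X n - (\<Sum>l=1..M. h l n) / P0) \<in> o(\<lambda>n. complex_of_real (H n))"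
  proof -
    have invQ: "(\<lambda>n. 1 / Q n) \<longlonglongrightarrow> 1 / P0"
      by (intro tendsto_intros Q_lim P0)
    then have "(\<lambda>n. 1 / Q n) \<in> O(\<lambda>_. 1)"
      by (intro bigoI_tendsto[where c = "1 / P0"]) auto
    from landau_o.small_big_mult[OF num this]
    have 1: "(\<lambda>n. ((\<Sum>j\<le>k. lam n j * b (n + j)) - (\<Sum>l=1..M. h l n)) * (1 / Q n)) \<in> o(\<lambda>n. complex_of_real (H n))"
      by simp
    have "(\<lambda>n. 1 / Q n - 1 / P0) \<in> o(\<lambda>_. 1)"
      using tendsto_diff[OF invQ tendsto_const[of "1 / P0"]] by (intro smalloI_tendsto) auto
    from landau_o.big_small_mult[OF sum_h this]
    have 2: "(\<lambda>n. (\<Sum>l=1..M. h l n) * (1 / Q n - 1 / P0)) \<in> o(\<lambda>n. complex_of_real (H n))"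
      by simp
    show ?thesis
      using sum_in_smallo(1)[OF 1 2] by (simp add: X_eq algebra_simps diff_divide_distrib)
  qed

  \<comment> \<open>Asymptotic equality with the sum of leading terms\<close>
  have H_eq: "H n = (\<Sum>l=1..M. norm (g l n)) * norm (1 / of_nat n ^ (2 * m 1) :: complex)" for n
    by (simp add: H_def h_def norm_divide sum_divide_distrib)
  have sum_h_eq: "(\<Sum>l=1..M. h l n) / P0 = (\<Sum>l=1..M. g l n) / poly P (1 / \<rho>) * (1 / of_nat n ^ (2 * m 1))" for n
    by (simp add: h_def P0_def sum_divide_distrib mult.commute)

  have "asymp_equiv_sum sequentially X {1..M} (\<lambda>l n. g l n / poly P (1 / \<rho>) * (1 / of_nat n ^ (2 * m 1)))"
  proof -
    have "(\<Sum>l=1..M. norm (g l n / poly P (1 / \<rho>) * (1 / of_nat n ^ (2 * m 1)))) = H n / norm P0" for n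
      by (simp add: H_def h_def P0_def norm_divide norm_mult sum_divide_distrib mult_ac)
    moreover have "(\<Sum>l=1..M. g l n / poly P (1 / \<rho>) * (1 / of_nat n ^ (2 * m 1))) = (\<Sum>l=1..M. h l n) / P0" for n
      by (simp add: h_def P0_def sum_divide_distrib mult.commute)
    ultimately show ?thesis
      using X P0 by (simp add: asymp_equiv_sum_def norm_smallo_iff)
  qed
  moreover have "X \<sim>[F] (\<lambda>n. (\<Sum>l=1..M. g l n) / poly P (1 / \<rho>) * (1 / of_nat n ^ (2 * m 1)))"
    if F: "F \<le> sequentially" and nc: "noncancelling F {1..M} g" for F
  proof -
    \<comment> \<open>Without cancellation along \<open>F\<close>, the sum of moduli is bounded by
      the modulus of the sum, up to a constant; being small against the former then means being
      small against the latter.\<close>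
    have "(\<lambda>n. H n) \<in> O[F](\<lambda>n. norm (\<Sum>l=1..M. g l n) * norm (1 / of_nat n ^ (2 * m 1) :: complex))"
      unfolding H_eq using nc unfolding noncancelling_def by (intro landau_o.big_mult) auto
    also have "(\<lambda>n. norm (\<Sum>l=1..M. g l n) * norm (1 / of_nat n ^ (2 * m 1) :: complex))
        = (\<lambda>n. norm (P0 * ((\<Sum>l=1..M. h l n) / P0)))"
      using P0 by (simp add: h_def norm_divide sum_divide_distrib flip: sum_divide_distrib)
    finally have "(\<lambda>n. complex_of_real (H n)) \<in> O[F](\<lambda>n. P0 * ((\<Sum>l=1..M. h l n) / P0))"
      by (simp add: bigo_def)
    then have "(\<lambda>n. complex_of_real (H n)) \<in> O[F](\<lambda>n. (\<Sum>l=1..M. h l n) / P0)"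
      using P0 by simp
    with landau_o.small.filter_mono[OF F X] have "(\<lambda>n. X n - (\<Sum>l=1..M. h l n) / P0) \<in> o[F](\<lambda>n. (\<Sum>l=1..M. h l n) / P0)"
      by (rule landau_o.small_big_trans)
    then show ?thesis
      unfolding asymp_equiv_altdef sum_h_eq .
  qed

  \<comment> \<open>Order of acceleration\<close>
  moreover have "(\<lambda>n. norm ((levin_transform k lam S \<omega> n - s) / (S n - s)))
             \<in> O[F](\<lambda>n. real n powr (- real (2 * m 1) - 0))"
    if c0: "\<forall>l\<in>{1..M}. c l 0 \<noteq> 0" and F: "F \<le> sequentially"
      and nc: "noncancelling F {1..M} (\<lambda>l n. \<zeta> l ^ n * c l 0)" for F
  proof -
    \<comment> \<open>The leading part of the error \<open>b\<close>. Both errors are compared with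
      \<open>W\<close>: \<open>X\<close> is at most of order \<open>W n / n ^ (2 * m 1)\<close>, and
      \<open>b\<close> is at least of order \<open>W n\<close> along \<open>F\<close>.\<close>
    let ?L = "\<lambda>n. \<Sum>l=1..M. \<zeta> l ^ n * c l 0"
    have "norm (g l n) \<le> norm (G l) * norm (\<zeta> l) ^ n" if l: "l \<in> {1..M}" and n: "n \<ge> 1" for l n
    proof -
      have "norm (g l n) = norm (G l) * norm (\<zeta> l) ^ n / real n ^ (r l + m l - m 1)"
        using g l by (simp add: G_def norm_mult norm_divide norm_power power_add mult_ac)
      also have "\<dots> \<le> norm (G l) * norm (\<zeta> l) ^ n / 1"
        using n by (intro divide_left_mono) auto
      finally show ?thesis by simp
    qed
    moreover have "norm (G l) \<le> (\<Sum>l=1..M. norm (G l))" if "l \<in> {1..M}" for l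
      using that by (intro member_le_sum) auto
    ultimately have "norm (g l n) \<le> (\<Sum>l=1..M. norm (G l)) * norm (\<zeta> l) ^ n" if "l \<in> {1..M}" "n \<ge> 1" for l n
      using that by (meson mult_right_mono norm_ge_zero order_trans zero_le_power)
    then have "(\<Sum>l=1..M. norm (g l n)) \<le> (\<Sum>l=1..M. norm (G l)) * W n" if "n \<ge> 1" for n
      unfolding W_def sum_distrib_left[of "\<Sum>l=1..M. norm (G l)"] using that by (intro sum_mono) auto
    then have "(\<lambda>n. \<Sum>l=1..M. norm (g l n)) \<in> O(W)"
      by (intro bigoI[where c = "\<Sum>l=1..M. norm (G l)"] eventually_mono[OF eventually_ge_at_top[of 1]])
        (auto simp: sum_nonneg W_def)
    then have "H \<in> O(\<lambda>n. W n * norm (1 / of_nat n ^ (2 * m 1) :: complex))"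
      unfolding H_eq by (intro landau_o.big_mult) auto
    then have HW: "(\<lambda>n. complex_of_real (H n)) \<in> O(\<lambda>n. complex_of_real (W n) * (1 / of_nat n ^ (2 * m 1)))"
      by (simp add: bigo_def norm_mult norm_divide norm_power abs_mult)
    have "(\<lambda>n. (X n - (\<Sum>l=1..M. h l n) / P0) + (\<Sum>l=1..M. h l n) / P0) \<in> O(\<lambda>n. complex_of_real (H n))"
      using landau_o.small_imp_big[OF X] sum_h P0 by (intro sum_in_bigo(1)) auto
    then have XW: "X \<in> O[F](\<lambda>n. complex_of_real (W n) * (1 / of_nat n ^ (2 * m 1)))"
      using landau_o.big.filter_mono[OF F landau_o.big_trans[OF _ HW]] by simp

    \<comment> \<open>As no \<open>c l 0\<close> is 0, \<open>W\<close> is bounded by the moduli of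
      the terms of \<open>?L\<close>, and noncancellation passes from these to \<open>?L\<close>
      itself.\<close>
    have WL: "(\<lambda>n. complex_of_real (W n)) \<in> O[F](?L)"
    proof -
      have "norm (\<zeta> l) ^ n \<le> (\<Sum>l=1..M. 1 / norm (c l 0)) * norm (\<zeta> l ^ n * c l 0)" if l: "l \<in> {1..M}" for l n
      proof -
        have "norm (\<zeta> l) ^ n = 1 / norm (c l 0) * norm (\<zeta> l ^ n * c l 0)"
          using c0 l by (simp add: norm_mult norm_power)
        also have "\<dots> \<le> (\<Sum>l=1..M. 1 / norm (c l 0)) * norm (\<zeta> l ^ n * c l 0)"
          using l by (intro mult_right_mono member_le_sum) auto
        finally show ?thesis .
      qed
      then have "W n \<le> (\<Sum>l=1..M. 1 / norm (c l 0)) * (\<Sum>l=1..M. norm (\<zeta> l ^ n * c l 0))" for n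
        unfolding W_def sum_distrib_left[of "\<Sum>l=1..M. 1 / norm (c l 0)"] by (intro sum_mono) auto
      then have "W \<in> O[F](\<lambda>n. \<Sum>l=1..M. norm (\<zeta> l ^ n * c l 0))"
        by (intro bigoI[where c = "\<Sum>l=1..M. 1 / norm (c l 0)"] always_eventually)
          (auto simp: sum_nonneg W_def)
      from landau_o.big_trans[OF this nc[unfolded noncancelling_def]] show ?thesis
        by (simp add: bigo_def)
    qed
    \<comment> \<open>The error expansion truncated at order 0.\<close>
    have "(\<lambda>n. b n - ?L n) \<in> o(\<lambda>n. complex_of_real (W n))"
      using S_expansion[unfolded exp_power_expansion_def, THEN spec, of 0]
      by (simp add: b_def W_def norm_smallo_iff)
    then have "(\<lambda>n. b n - ?L n) \<in> o[F](?L)"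
      using landau_o.small_big_trans[OF landau_o.small.filter_mono[OF F] WL] by blast
    then have "b \<sim>[F] ?L"
      by (simp add: asymp_equiv_altdef)
    then have "?L \<in> O[F](b)"
      by (simp add: asymp_equiv_imp_bigo asymp_equiv_sym)
    then have "(\<lambda>n. complex_of_real (W n) * (1 / of_nat n ^ (2 * m 1))) \<in> O[F](\<lambda>n. b n * (1 / of_nat n ^ (2 * m 1)))"
      using WL by (intro landau_o.big_mult) (auto intro: landau_o.big_trans)
    with XW have "X \<in> O[F](\<lambda>n. b n * (1 / of_nat n ^ (2 * m 1)))"
      by (rule landau_o.big_trans)
    then obtain C where "C > 0" and C: "\<forall>\<^sub>F n in F. norm (X n) \<le> C * norm (b n * (1 / of_nat n ^ (2 * m 1)))"
      by (elim landau_o.bigE)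
    have "\<forall>\<^sub>F n in F. n > 0"
      using F eventually_gt_at_top[of 0] by (rule filter_leD)
    with C have "\<forall>\<^sub>F n in F. norm ((levin_transform k lam S \<omega> n - s) / (S n - s))
        \<le> C * (real n powr (- real (2 * m 1) - 0))"
    proof eventually_elim
      case (elim n)
      \<comment> \<open>This includes the case \<open>S n = s\<close>, where both quotients are 0 by
        the convention on division.\<close>
      have "(levin_transform k lam S \<omega> n - s) / (S n - s) = X n / b n"
        using omega_nz[of n] by (simp add: X_def b_def)
      also have "norm \<dots> \<le> C * norm (b n * (1 / of_nat n ^ (2 * m 1))) / norm (b n)"
        unfolding norm_divide using elim by (intro divide_right_mono) auto
      also have "\<dots> \<le> C * (1 / real n ^ (2 * m 1))"
        using \<open>C > 0\<close> by (cases "b n = 0") (auto simp: norm_mult norm_divide norm_power)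
      \<comment> \<open>The subtracted 0 is the value chosen for \<open>\<tau>\<close>.\<close>
      also have "1 / real n ^ (2 * m 1) = real n powr (- real (2 * m 1) - 0)"
        using elim by (simp add: powr_minus powr_realpow inverse_eq_divide flip: powr_realpow)
      finally show ?case .
    qed
    then show ?thesis
      by (intro bigoI[where c = C]) auto
  qed
  ultimately show ?thesis
    unfolding X_def by blast
qed

end
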